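(* Let $A$ be an entrywise nonnegative $7$-by-$n$ real matrix of (classical) rank $3$. Then the nonnegative rank of $A$ does not exceed $6$.
   Context: The nonnegative rank of a nonnegative matrix $A\in\mathbb{R}_+^{m\times n}$ is the smallest integer $k$ such that $A=BC$ for some entrywise nonnegative $B\in\mathbb{R}_+^{m\times k}$ and $C\in\mathbb{R}_+^{k\times n}$. *)

theory Defs
  imports "Jordan_Normal_Form.DL_Rank"
begin

definition nonneg_mat :: "real mat \<Rightarrow> bool" where
  "nonneg_mat A \<longleftrightarrow> (\<forall>i < dim_row A. \<forall>j < dim_col A. 0 \<le> A $$ (i, j))"

definition nonneg_factorization :: "real mat \<Rightarrow> nat \<Rightarrow> real mat \<Rightarrow> real mat \<Rightarrow> bool" where
  "nonneg_factorization A k B C \<longleftrightarrow>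
     B \<in> carrier_mat (dim_row A) k \<and> C \<in> carrier_mat k (dim_col A) \<and>
     nonneg_mat B \<and> nonneg_mat C \<and> A = B * C"

(* Only meaningful for nonnegative A; otherwise no factorization exists and LEAST is unspecified. *)
definition nonneg_rank :: "real mat \<Rightarrow> nat" where
  "nonneg_rank A = (LEAST k. \<exists>B C. nonneg_factorization A k B C)"

lemma nonneg_rank_attained:
  assumes "nonneg_mat A"
  shows "\<exists>B C. nonneg_factorization A (nonneg_rank A) B C"
proof -
  have "nonneg_factorization A (dim_row A) (1\<^sub>m (dim_row A)) A"
    unfolding nonneg_factorization_def
  proof (intro conjI)
    show "1\<^sub>m (dim_row A) \<in> carrier_mat (dim_row A) (dim_row A)"
      by (rule one_carrier_mat)
    show "A \<in> carrier_mat (dim_row A) (dim_col A)"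
      by (rule carrier_matI) (rule refl)+
    show "nonneg_mat (1\<^sub>m (dim_row A))"
      by (simp add: nonneg_mat_def)
    show "A = 1\<^sub>m (dim_row A) * A"
      by (rule left_mult_one_mat'[OF refl, symmetric])
  qed (fact assms)
  then have "\<exists>B C. nonneg_factorization A (dim_row A) B C"
    by blast
  then show ?thesis
    unfolding nonneg_rank_def by (rule LeastI)
qed

end

(* Write A(i,j) = u_i . w_j with u_i, w_j in R^3. If some u_i is a nonnegative combination of the
   others, its row of A can be dropped. Otherwise, in cyclic order, the u_i span the rays over a strictly
   convex heptagon P_0, ..., P_6, and it suffices to realise this heptagon as a planar section of a
   polytope with three vertices p_1, p_2, p_3 above the plane and three vertices q_1, q_2, q_3 below:
   seven of the nine edges p_a q_b cross the plane in the P_i, the other two inside the heptagon.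
   The edges p_1q_1 and p_2q_2 are the exceptional ones when P_0, ..., P_6 are placed on p_3q_3, p_1q_3, p_1q_2,
   p_3q_2, p_3q_1, p_2q_1, p_2q_3; the scaling factors are then forced by the four-point relations of
   P_0 P_1 P_2 P_3 and P_0 P_4 P_5 P_6 and are positive. Their crossing points lie in the heptagon iff the line joining
   P_0 to the intersection of P_1P_2 and P_5P_6 leaves the heptagon through the edge P_3P_4.
   Some vertex can play the role of P_0: if the line from P_r deviates to one side, the line
   from P_(r+3) does not deviate to the other, so if all lines deviate, they do so to the same side (3 is
   coprime to 7); this is refuted by multiplying the seven resulting inequalities. *)

theory Submission
  imports Defs "HOL-Analysis.Product_Vector"
begin

section \<open>Determinants of vectors in three-space\<close>

type_synonym vec3 = "real \<times> real \<times> real"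

fun det3 :: "vec3 \<Rightarrow> vec3 \<Rightarrow> vec3 \<Rightarrow> real" where
  "det3 (a1, a2, a3) (b1, b2, b3) (c1, c2, c3) =
     a1 * (b2 * c3 - b3 * c2) - a2 * (b1 * c3 - b3 * c1) + a3 * (b1 * c2 - b2 * c1)"

fun dot3 :: "vec3 \<Rightarrow> vec3 \<Rightarrow> real" where
  "dot3 (a1, a2, a3) (b1, b2, b3) = a1 * b1 + a2 * b2 + a3 * b3"

lemma det3_cyclic: "det3 b c a = det3 a b c"
  by (cases a; cases b; cases c) (simp add: algebra_simps)

lemma det3_swap: "det3 a c b = - det3 a b c" "det3 b a c = - det3 a b c"
  by (cases a; cases b; cases c; simp add: algebra_simps)+

lemma det3_same: "det3 a b b = 0" "det3 a b a = 0" "det3 a a b = 0"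
  by (cases a; cases b; simp add: algebra_simps)+

lemma dot3_linear:
  "dot3 (a + b) w = dot3 a w + dot3 b w" "dot3 (- a) w = - dot3 a w" "dot3 (x *\<^sub>R a) w = x * dot3 a w"
  "dot3 0 w = 0"
  by (cases a; cases b; cases w; simp add: algebra_simps zero_prod_def)+

lemma dot3_sum_right: "dot3 a (sum f S) = (\<Sum>s\<in>S. dot3 a (f s))"
proof -
  have "dot3 a (v + w) = dot3 a v + dot3 a w" "dot3 a 0 = 0" for v w
    by (cases a; cases v; cases w; simp add: algebra_simps zero_prod_def)+
  then show ?thesis by (induction S rule: infinite_finite_induct) simp_all
qed

text \<open>The three-term Grassmann-Pluecker relation: 2-by-2 determinants in the quotient by
  \<open>p\<close>. It is the source of the comparisons between products of heptagon
  determinants.\<close>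

lemma plucker:
  "det3 p a c * det3 p b d = det3 p a b * det3 p c d + det3 p a d * det3 p b c"
  by (cases p; cases a; cases b; cases c; cases d) (simp add: algebra_simps)

text \<open>Nothing is divided by \<open>det3 a b c\<close>, so a linear relation among
  \<open>a\<close>, \<open>b\<close>, \<open>c\<close> remains when that determinant
  vanishes.\<close>

lemma cramer:
  "det3 a b c *\<^sub>R d = det3 d b c *\<^sub>R a + det3 a d c *\<^sub>R b + det3 a b d *\<^sub>R c"
  by (cases a; cases b; cases c; cases d) (simp add: algebra_simps)

lemma cramer_dot:
  "det3 a b c * dot3 d w = det3 d b c * dot3 a w + det3 a d c * dot3 b w + det3 a b d * dot3 c w"
  using arg_cong[OF cramer[of a b c d], of "\<lambda>v. dot3 v w"] by (simp add: dot3_linear)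

text \<open>Unit vectors as \<open>d\<close> show that the cross product of \<open>a\<close> and
  \<open>b\<close> is zero; expanding its cross product with \<open>e\<close> gives the
  claim.\<close>

lemma det3_zero_imp_parallel:
  assumes "\<And>d. det3 a b d = 0"
  shows "dot3 b e *\<^sub>R a = dot3 a e *\<^sub>R b"
proof -
  obtain a1 a2 a3 b1 b2 b3 e1 e2 e3 where a: "a = (a1, a2, a3)" and b: "b = (b1, b2, b3)"
    and e: "e = (e1, e2, e3)" by (cases a; cases b; cases e)
  have 1: "a2 * b3 = a3 * b2" "a1 * b3 = a3 * b1" "a1 * b2 = a2 * b1"
    using assms[of "(1, 0, 0)"] assms[of "(0, 1, 0)"] assms[of "(0, 0, 1)"] by (auto simp: a b)
  have "(b1 * e1 + b2 * e2 + b3 * e3) * a1 - (a1 * e1 + a2 * e2 + a3 * e3) * b1 =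
      e2 * (a1 * b2 - a2 * b1) + e3 * (a1 * b3 - a3 * b1)"
    "(b1 * e1 + b2 * e2 + b3 * e3) * a2 - (a1 * e1 + a2 * e2 + a3 * e3) * b2 =
      e3 * (a2 * b3 - a3 * b2) - e1 * (a1 * b2 - a2 * b1)"
    "(b1 * e1 + b2 * e2 + b3 * e3) * a3 - (a1 * e1 + a2 * e2 + a3 * e3) * b3 =
      - e1 * (a1 * b3 - a3 * b1) - e2 * (a2 * b3 - a3 * b2)"
    by (simp_all add: algebra_simps)
  with 1 show ?thesis
    by (simp add: a b e)
qed

text \<open>Combinations of three vectors suffice to express extremality, by Caratheodory's theorem.\<close>

locale convex_position =
  fixes u :: "'i \<Rightarrow> vec3" and I :: "'i set" and e :: vec3
  assumes pos: "i \<in> I \<Longrightarrow> 0 < dot3 (u i) e"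
    and extreme: "\<lbrakk>i \<in> I; j \<in> I; k \<in> I; l \<in> I; i \<notin> {j, k, l}; 0 \<le> x; 0 \<le> y; 0 \<le> z\<rbrakk> \<Longrightarrow>
      u i \<noteq> x *\<^sub>R u j + y *\<^sub>R u k + z *\<^sub>R u l"
begin

lemma extreme_scaled:
  assumes "{i, j, k, l} \<subseteq> I" "i \<notin> {j, k, l}" "0 < t" "0 \<le> x" "0 \<le> y" "0 \<le> z"
  shows "t *\<^sub>R u i \<noteq> x *\<^sub>R u j + y *\<^sub>R u k + z *\<^sub>R u l"
proof
  assume "t *\<^sub>R u i = x *\<^sub>R u j + y *\<^sub>R u k + z *\<^sub>R u l"
  then have "(1 / t) *\<^sub>R (t *\<^sub>R u i) = (1 / t) *\<^sub>R (x *\<^sub>R u j + y *\<^sub>R u k + z *\<^sub>R u l)"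
    by simp
  then have "u i = (x / t) *\<^sub>R u j + (y / t) *\<^sub>R u k + (z / t) *\<^sub>R u l"
    using assms(3) by (simp add: scaleR_add_right)
  moreover have "u i \<noteq> (x / t) *\<^sub>R u j + (y / t) *\<^sub>R u k + (z / t) *\<^sub>R u l"
    using assms by (intro extreme) auto
  ultimately show False by simp
qed

text \<open>If \<open>x > 0\<close>, each sign pattern of \<open>y\<close> and \<open>z\<close>
  either puts one vector into the cone of the other two or, with all coefficients nonnegative,
  contradicts positivity against \<open>e\<close>. Applied to a relation and to its negative, this
  makes the coefficient vanish.\<close>

lemma relation_coeff_nonpos:
  assumes "{i, j, k} \<subseteq> I" "i \<noteq> j" "i \<noteq> k" "j \<noteq> k"
    and rel: "x *\<^sub>R u i + y *\<^sub>R u j + z *\<^sub>R u k = 0"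
  shows "x \<le> 0"
proof (rule ccontr)
  assume x: "\<not> x \<le> 0"
  have e0: "x * dot3 (u i) e + y * dot3 (u j) e + z * dot3 (u k) e = 0"
    using arg_cong[OF rel, of "\<lambda>v. dot3 v e"] by (simp add: dot3_linear)
  have neg: "- a = b + c" "- b = a + c" "- c = a + b" if "a + b + c = 0" for a b c :: vec3
    using that by (cases a; cases b; cases c; auto simp: zero_prod_def)+
  consider "y \<le> 0" "z \<le> 0" | "y < 0" "0 \<le> z" | "0 \<le> y" "z < 0" | "0 \<le> y" "0 \<le> z" by linarith
  then show False
  proof cases
    case 1
    have "x *\<^sub>R u i = (- y) *\<^sub>R u j + (- z) *\<^sub>R u k + 0 *\<^sub>R u k"
      using arg_cong[OF neg(1)[OF rel], of uminus] by simp
    then show False using extreme_scaled[of i j k k x "- y" "- z" 0] assms x 1 by auto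
  next
    case 2
    have "(- y) *\<^sub>R u j = x *\<^sub>R u i + z *\<^sub>R u k + 0 *\<^sub>R u k"
      using neg(2)[OF rel] by simp
    then show False using extreme_scaled[of j i k k "- y" x z 0] assms x 2 by auto
  next
    case 3
    have "(- z) *\<^sub>R u k = x *\<^sub>R u i + y *\<^sub>R u j + 0 *\<^sub>R u j"
      using neg(3)[OF rel] by simp
    then show False using extreme_scaled[of k i j j "- z" x y 0] assms x 3 by auto
  next
    case 4
    have "0 < dot3 (u i) e" "0 < dot3 (u j) e" "0 < dot3 (u k) e" using pos assms by auto
    then have "0 < x * dot3 (u i) e" "0 \<le> y * dot3 (u j) e" "0 \<le> z * dot3 (u k) e"
      using x 4 by auto
    then show False using e0 by linarith
  qed
qed

text \<open>With determinant zero, Cramer's rule for any \<open>d\<close> relates the three vectors,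
  so the coefficient \<open>det3 d (u j) (u k)\<close> is always zero; then \<open>u j\<close> and
  \<open>u k\<close> are parallel, against extremality.\<close>

lemma det3_nonzero:
  assumes I: "{i, j, k} \<subseteq> I" "i \<noteq> j" "i \<noteq> k" "j \<noteq> k"
  shows "det3 (u i) (u j) (u k) \<noteq> 0"
proof
  assume 0: "det3 (u i) (u j) (u k) = 0"
  have j: "0 < dot3 (u j) e" and k: "0 < dot3 (u k) e" using I pos by auto
  have "det3 (u j) (u k) d = 0" for d
  proof (rule ccontr)
    assume d: "det3 (u j) (u k) d \<noteq> 0"
    define x y z where "x = det3 d (u j) (u k)" and "y = det3 (u i) d (u k)" and "z = det3 (u i) (u j) d"
    have "x *\<^sub>R u i + y *\<^sub>R u j + z *\<^sub>R u k = 0"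
      using cramer[of "u i" "u j" "u k" d] by (simp add: 0 x_def y_def z_def)
    moreover from this have "(- 1) *\<^sub>R (x *\<^sub>R u i + y *\<^sub>R u j + z *\<^sub>R u k) = 0"
      by simp
    then have "(- x) *\<^sub>R u i + (- y) *\<^sub>R u j + (- z) *\<^sub>R u k = 0"
      unfolding scaleR_add_right scaleR_scaleR by simp
    ultimately have "x = 0" using relation_coeff_nonpos[OF I, of x y z] relation_coeff_nonpos[OF I, of "- x" "- y" "- z"] by simp
    with d show False by (simp add: x_def det3_cyclic)
  qed
  then have "dot3 (u k) e *\<^sub>R u j = dot3 (u j) e *\<^sub>R u k + 0 *\<^sub>R u k + 0 *\<^sub>R u k"
    using det3_zero_imp_parallel by simp
  then show False using extreme_scaled[of j k k k "dot3 (u k) e" "dot3 (u j) e" 0 0] I j k by auto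
qed

text \<open>Otherwise \<open>u i\<close>, \<open>u j\<close>, \<open>u k\<close> wind around
  \<open>u h\<close>, and Cramer's rule puts \<open>u h\<close> into their cone; pairing with
  \<open>e\<close> shows that its factor \<open>s\<close> is positive. Hence the angle around
  \<open>u h\<close> orders the other vectors linearly.\<close>

lemma det3_trans:
  assumes I: "{h, i, j, k} \<subseteq> I" and "0 < det3 (u h) (u i) (u j)" "0 < det3 (u h) (u j) (u k)"
  shows "0 < det3 (u h) (u i) (u k)"
proof (rule ccontr)
  assume "\<not> ?thesis"
  moreover have ne: "h \<noteq> i" "h \<noteq> j" "h \<noteq> k" "i \<noteq> j" "j \<noteq> k" "i \<noteq> k"
    using assms det3_swap(1)[of "u h" "u i" "u j"] by (auto simp: det3_same)
  moreover from ne have "det3 (u h) (u i) (u k) \<noteq> 0" using det3_nonzero I by auto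
  ultimately have ik: "0 < det3 (u h) (u k) (u i)" by (simp add: det3_swap(1)[of "u h" "u k" "u i"])
  define s where "s = det3 (u i) (u j) (u k)"
  have rel: "s *\<^sub>R u h = det3 (u h) (u j) (u k) *\<^sub>R u i + det3 (u h) (u k) (u i) *\<^sub>R u j
      + det3 (u h) (u i) (u j) *\<^sub>R u k"
    using cramer[of "u i" "u j" "u k" "u h"]
    by (simp add: s_def det3_cyclic[of "u h" "u k" "u i"] det3_cyclic[of "u i" "u j" "u h"])
  have "0 < s * dot3 (u h) e"
    using arg_cong[OF rel, of "\<lambda>v. dot3 v e"] assms ik pos by (simp add: dot3_linear add_pos_pos)
  then have "0 < s" using pos[of h] I by (simp add: zero_less_mult_iff)
  moreover from this have "s *\<^sub>R u h \<noteq> det3 (u h) (u j) (u k) *\<^sub>R u i + det3 (u h) (u k) (u i) *\<^sub>R u j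
      + det3 (u h) (u i) (u j) *\<^sub>R u k"
    using I ne assms ik by (intro extreme_scaled) auto
  ultimately show False using rel by simp
qed

text \<open>Otherwise \<open>u j\<close> lies in the cone of \<open>u h\<close>, \<open>u i\<close>,
  \<open>u k\<close>. Thus the order seen from \<open>u h\<close> fixes the orientation of triples
  that avoid it.\<close>

lemma det3_pos:
  assumes I: "{h, i, j, k} \<subseteq> I" and "0 < det3 (u h) (u i) (u j)" "0 < det3 (u h) (u j) (u k)"
  shows "0 < det3 (u i) (u j) (u k)"
proof (rule ccontr)
  assume neg: "\<not> ?thesis"
  have ik: "0 < det3 (u h) (u i) (u k)" using det3_trans assms by blast
  have ne: "h \<noteq> i" "h \<noteq> j" "h \<noteq> k" "i \<noteq> j" "j \<noteq> k" "i \<noteq> k"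
    using assms ik by (auto simp: det3_same)
  have "det3 (u h) (u i) (u k) *\<^sub>R u j = det3 (u h) (u j) (u k) *\<^sub>R u i
    + det3 (u h) (u i) (u j) *\<^sub>R u k + (- det3 (u i) (u j) (u k)) *\<^sub>R u h"
    using cramer[of "u h" "u i" "u k" "u j"] by (simp add: det3_swap(2)[of "u i" "u j" "u k"])
  moreover have "det3 (u h) (u i) (u k) *\<^sub>R u j \<noteq> det3 (u h) (u j) (u k) *\<^sub>R u i
    + det3 (u h) (u i) (u j) *\<^sub>R u k + (- det3 (u i) (u j) (u k)) *\<^sub>R u h"
    using I ne assms ik neg by (intro extreme_scaled) auto
  ultimately show False by simp
qed

end

section \<open>Cyclic order of vectors in convex position\<close>

text \<open>The new element splits the sorted list into its predecessors and the rest; totality puts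
  the rest after it, and transitivity through it compares the two halves.\<close>

lemma sorted_enumeration:
  assumes "finite S"
    and "\<And>x y. \<lbrakk>x \<in> S; y \<in> S; x \<noteq> y\<rbrakk> \<Longrightarrow> R x y \<or> R y x"
    and "\<And>x y z. \<lbrakk>x \<in> S; y \<in> S; z \<in> S; R x y; R y z\<rbrakk> \<Longrightarrow> R x z"
  shows "\<exists>xs. set xs = S \<and> distinct xs \<and> sorted_wrt R xs"
  using assms
proof (induction S rule: finite_induct)
  case empty
  show ?case by (rule exI[of _ "[]"]) simp
next
  case (insert x S)
  have total: "R a b \<or> R b a" if "a \<in> insert x S" "b \<in> insert x S" "a \<noteq> b" for a b
    using insert.prems(1)[of a b] that by simp
  have trans: "R a c" if "R a b" "R b c" "a \<in> insert x S" "b \<in> insert x S" "c \<in> insert x S" for a b c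
    using insert.prems(2)[of a b c] that by simp
  have "\<exists>xs. set xs = S \<and> distinct xs \<and> sorted_wrt R xs"
    by (rule insert.IH) (use total in blast, rule trans, auto)
  then obtain xs where xs: "set xs = S" "distinct xs" "sorted_wrt R xs"
    by blast
  define ls gs where "ls = filter (\<lambda>y. R y x) xs" and "gs = filter (\<lambda>y. \<not> R y x) xs"
  have ls: "R y x" "y \<in> S" if "y \<in> set ls" for y
    using that xs by (auto simp: ls_def)
  have gs: "R x y" "y \<in> S" if "y \<in> set gs" for y
    using that xs insert.hyps total[of x y] by (auto simp: gs_def)
  have "sorted_wrt R (ls @ x # gs)"
    unfolding sorted_wrt_append
  proof (intro conjI ballI)
    show "sorted_wrt R ls"
      using xs by (simp add: ls_def sorted_wrt_filter)
    have "sorted_wrt R gs"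
      using xs by (simp add: gs_def sorted_wrt_filter)
    then show "sorted_wrt R (x # gs)"
      using gs(1) by simp
    show "R a b" if "a \<in> set ls" "b \<in> set (x # gs)" for a b
    proof (cases "b = x")
      case True
      then show ?thesis using ls that by simp
    next
      case False
      then have "b \<in> set gs" using that by simp
      then show ?thesis using trans[of a x b] ls[OF that(1)] gs[of b] by simp
    qed
  qed
  moreover have "set (ls @ x # gs) = insert x S" "distinct (ls @ x # gs)"
    using xs insert.hyps by (auto simp: ls_def gs_def)
  ultimately show ?case by blast
qed

text \<open>Indexing by all naturals with period 7 turns rotations into index shifts; the bound
  \<open>k < i + 7\<close> admits exactly the triples in cyclic order within one turn.\<close>

definition convex_heptagon :: "(nat \<Rightarrow> vec3) \<Rightarrow> bool" where
  "convex_heptagon P \<longleftrightarrow> (\<forall>i. P (i + 7) = P i) \<and>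
     (\<forall>i j k. i < j \<and> j < k \<and> k < i + 7 \<longrightarrow> 0 < det3 (P i) (P j) (P k))"

lemma (in convex_position) obtain_heptagon:
  assumes "card I = 7"
  obtains P where "convex_heptagon P" "range P = u ` I"
proof -
  have "finite I" using assms card.infinite by fastforce
  obtain h where h: "h \<in> I" using assms by fastforce
  have "\<exists>xs. set xs = I - {h} \<and> distinct xs \<and> sorted_wrt (\<lambda>i j. 0 < det3 (u h) (u i) (u j)) xs"
  proof (rule sorted_enumeration)
    show "0 < det3 (u h) (u i) (u j) \<or> 0 < det3 (u h) (u j) (u i)"
      if "i \<in> I - {h}" "j \<in> I - {h}" "i \<noteq> j" for i j
      using det3_nonzero[of h i j] that h det3_swap(1)[of "u h" "u i" "u j"] by auto
    show "0 < det3 (u h) (u i) (u k)" if "i \<in> I - {h}" "j \<in> I - {h}" "k \<in> I - {h}"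
      "0 < det3 (u h) (u i) (u j)" "0 < det3 (u h) (u j) (u k)" for i j k
      using det3_trans[of h i j k] that h by auto
  qed (use \<open>finite I\<close> in simp)
  then obtain xs where xs: "set xs = I - {h}" "distinct xs"
    "sorted_wrt (\<lambda>i j. 0 < det3 (u h) (u i) (u j)) xs" by blast
  define ys where "ys = h # xs"
  have set_ys: "set ys = I" and len: "length ys = 7"
    using xs h distinct_card[of xs] \<open>finite I\<close> assms by (auto simp: ys_def)
  have base: "0 < det3 (u (ys ! a)) (u (ys ! b)) (u (ys ! c))" if "a < b" "b < c" "c < 7" for a b c
  proof -
    have h_pos: "0 < det3 (u h) (u (ys ! b')) (u (ys ! c'))" if "0 < b'" "b' < c'" "c' < 7" for b' c'
      using that len sorted_wrt_nth_less[OF xs(3), of "b' - 1" "c' - 1"] by (simp add: ys_def)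
    show ?thesis
    proof (cases "a = 0")
      case True
      then show ?thesis using h_pos[of b c] that by (simp add: ys_def)
    next
      case False
      have "{h, ys ! a, ys ! b, ys ! c} \<subseteq> I"
        using that len h set_ys nth_mem[of _ ys] by (metis insert_subset empty_subsetI less_trans)
      then show ?thesis using det3_pos h_pos that False by (meson gr0I less_trans)
    qed
  qed
  define P where "P i = u (ys ! (i mod 7))" for i
  have "0 < det3 (P i) (P j) (P k)" if ijk: "i < j" "j < k" "k < i + 7" for i j k
  proof -
    define a s t where "a = i mod 7" and "s = j - i" and "t = k - i"
    have st: "0 < s" "s < t" "t < 7" "a < 7" using ijk by (auto simp: s_def t_def a_def)
    have red: "(i + r) mod 7 = (if a + r < 7 then a + r else a + r - 7)" if "r < 7" for r
      using that st by (auto simp: a_def mod_if[of "i mod 7 + r"] mod_add_left_eq[of i 7 r, symmetric])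
    have mods: "j mod 7 = (if a + s < 7 then a + s else a + s - 7)"
      "k mod 7 = (if a + t < 7 then a + t else a + t - 7)"
      using red[of s] red[of t] st ijk by (simp_all add: s_def t_def)
    \<comment> \<open>None, one or two of the three indices wrap past 7; a cyclic shift of the
      determinant restores increasing order.\<close>
    consider "a + t < 7" | "a + s < 7" "7 \<le> a + t" | "7 \<le> a + s" by linarith
    then show ?thesis
    proof cases
      case 1
      then show ?thesis using base[of a "a + s" "a + t"] st by (simp add: P_def mods a_def[symmetric])
    next
      case 2
      then have "0 < det3 (u (ys ! (a + t - 7))) (u (ys ! a)) (u (ys ! (a + s)))"
        using st by (intro base) auto
      then show ?thesis using 2 by (simp add: P_def mods a_def[symmetric] det3_cyclic)
    next
      case 3
      then have "0 < det3 (u (ys ! (a + s - 7))) (u (ys ! (a + t - 7))) (u (ys ! a))"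
        using st by (intro base) auto
      then show ?thesis using 3 st by (simp add: P_def mods a_def[symmetric] det3_cyclic)
    qed
  qed
  then have "convex_heptagon P" by (simp add: convex_heptagon_def P_def)
  moreover have "range P = u ` I"
  proof -
    have "range P = u ` (\<lambda>i. ys ! (i mod 7)) ` UNIV" by (auto simp: P_def)
    also have "(\<lambda>i. ys ! (i mod 7)) ` UNIV = set ys"
    proof -
      have "(\<lambda>i::nat. i mod 7) ` UNIV = {..<7}"
        by (auto simp: image_iff) (metis mod_less)
      then have "(!) ys ` (\<lambda>i::nat. i mod 7) ` UNIV = set ys"
        by (simp add: nth_image len lessThan_atLeast0)
      then show ?thesis by (simp add: image_image)
    qed
    finally show ?thesis by (simp add: set_ys)
  qed
  ultimately show thesis by (rule that)
qed

section \<open>Choice of the base vertex\<close>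

lemma prod_shift_periodic:
  fixes f :: "nat \<Rightarrow> real"
  assumes "\<And>i. f (i + Suc n) = f i"
  shows "(\<Prod>i<Suc n. f (i + k)) = (\<Prod>i<Suc n. f i)"
proof (induction k)
  case (Suc k)
  have "(\<Prod>i<Suc n. f (i + Suc k)) = (\<Prod>i<n. f (Suc i + k)) * f k"
    using assms[of k] by (simp add: algebra_simps)
  also have "\<dots> = (\<Prod>i<Suc n. f (i + k))"
    by (simp only: prod.lessThan_Suc_shift) simp
  finally show ?case using Suc by simp
qed simp

lemma prod_strict_mono:
  fixes f g :: "nat \<Rightarrow> real"
  assumes "\<And>i. 0 < f i" "\<And>i. f i < g i"
  shows "prod f {..<Suc n} < prod g {..<Suc n}"
proof (rule prod_mono_strict[of 0])
  show "0 < g i" for i using assms[of i] by linarith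
qed (use assms in \<open>auto intro: less_imp_le\<close>)

text \<open>Products over a full period ignore shifts, so the hypotheses multiply to
  \<open>C * B < A * A\<close> and \<open>A * C < B * B\<close>, which force \<open>C < A\<close>
  and \<open>C < B\<close>. If a conclusion failed for every \<open>r\<close>, the product of the
  reversed inequalities would contradict this.\<close>

lemma seven_periodic_products:
  fixes a b c :: "nat \<Rightarrow> real"
  assumes pos: "\<And>r. 0 < a r" "\<And>r. 0 < b r" "\<And>r. 0 < c r"
    and per: "\<And>r. a (r + 7) = a r" "\<And>r. b (r + 7) = b r" "\<And>r. c (r + 7) = c r"
    and ab: "\<And>r. c r * b (r + 1) < a r * a (r + 1)" "\<And>r. a r * c (r + 2) < b r * b (r + 1)"
  shows "\<exists>r. c (r + 5) * c (r + 1) \<le> c r * b (r + 3)" "\<exists>r. c r * c (r + 4) \<le> c (r + 5) * a (r + 1)"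
proof -
  define A B C where "A = (\<Prod>r<7. a r)" and "B = (\<Prod>r<7. b r)" and "C = (\<Prod>r<7. c r)"
  have ABC: "0 < A" "0 < B" "0 < C" by (auto simp: A_def B_def C_def pos intro: prod_pos)
  have shift: "(\<Prod>r<7. a (r + k)) = A" "(\<Prod>r<7. b (r + k)) = B" "(\<Prod>r<7. c (r + k)) = C" for k
    using prod_shift_periodic[of a 6 k] prod_shift_periodic[of b 6 k] prod_shift_periodic[of c 6 k] per
    by (simp_all add: A_def B_def C_def)
  have less: "prod f {..<7} < prod g {..<7}" if "\<And>i. 0 < f i" "\<And>i. f i < g i" for f g :: "nat \<Rightarrow> real"
    using prod_strict_mono[of f g 6] that by simp
  have 1: "C * B < A * A"
    using less[of "\<lambda>r. c r * b (r + 1)" "\<lambda>r. a r * a (r + 1)"] ab pos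
    unfolding prod.distrib shift A_def[symmetric] C_def[symmetric] by simp
  have 2: "A * C < B * B"
    using less[of "\<lambda>r. a r * c (r + 2)" "\<lambda>r. b r * b (r + 1)"] ab pos
    unfolding prod.distrib shift A_def[symmetric] B_def[symmetric] by simp
  have "C < A"
  proof (rule ccontr)
    assume "\<not> C < A"
    then have "A * A \<le> A * C" "A * C \<le> C * C" using ABC by simp_all
    then have "C * B < B * B" "C * B < C * C" using 1 2 by linarith+
    then show False using ABC by simp
  qed
  have "C < B"
  proof (rule ccontr)
    assume "\<not> C < B"
    then have "B * B \<le> C * B" "C * B \<le> C * C" using ABC by simp_all
    then have "A * C < A * A" "A * C < C * C" using 1 2 by linarith+
    then show False using ABC by simp
  qed
  show "\<exists>r. c (r + 5) * c (r + 1) \<le> c r * b (r + 3)"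
  proof (rule ccontr)
    assume "\<not> ?thesis"
    then have "C * B < C * C"
      using less[of "\<lambda>r. c r * b (r + 3)" "\<lambda>r. c (r + 5) * c (r + 1)"] pos
      unfolding prod.distrib shift C_def[symmetric] by (simp add: not_le)
    then show False using ABC \<open>C < B\<close> by simp
  qed
  show "\<exists>r. c r * c (r + 4) \<le> c (r + 5) * a (r + 1)"
  proof (rule ccontr)
    assume "\<not> ?thesis"
    then have "C * A < C * C"
      using less[of "\<lambda>r. c (r + 5) * a (r + 1)" "\<lambda>r. c r * c (r + 4)"] pos
      unfolding prod.distrib shift C_def[symmetric] by (simp add: not_le)
    then show False using ABC \<open>C < A\<close> by simp
  qed
qed

text \<open>The two inequalities place the line through \<open>P\<^sub>r\<close> described at the top between
  \<open>P\<^bsub>r+4\<^esub>\<close> and \<open>P\<^bsub>r+3\<^esub>\<close>; \<open>L\<close> and \<open>R\<close> in the proof are their negations.\<close>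

lemma balanced_vertex:
  assumes "convex_heptagon P"
  defines "d \<equiv> \<lambda>i j k. det3 (P i) (P j) (P k)"
  shows "\<exists>r. d r (r + 1) (r + 2) * d (r + 4) (r + 5) (r + 6) \<le> d r (r + 5) (r + 6) * d (r + 1) (r + 2) (r + 4) \<and>
    d r (r + 5) (r + 6) * d (r + 1) (r + 2) (r + 3) \<le> d r (r + 1) (r + 2) * d (r + 3) (r + 5) (r + 6)"
proof -
  have per: "P (i + 7) = P i" for i using assms(1) by (simp add: convex_heptagon_def)
  have pos: "0 < d i j k" if "i < j" "j < k" "k < i + 7" for i j k
    using assms(1) that by (simp add: convex_heptagon_def d_def)
  have cyc: "d i j k = d j k i" for i j k unfolding d_def by (rule det3_cyclic[symmetric])
  have pluck: "d p i k * d p j l = d p i j * d p k l + d p i l * d p j k" for p i j k l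
    unfolding d_def by (rule plucker)
  \<comment> \<open>These are determinants of triples among at most four consecutive vertices:
    \<open>c\<close> takes three in a row, \<open>a\<close> and \<open>b\<close> skip the third and
    the second of four.\<close>
  define a b c where "a r = d r (r + 1) (r + 3)" and "b r = d r (r + 2) (r + 3)"
    and "c r = d r (r + 1) (r + 2)" for r
  have wrap: "d r (r + 5) (r + 6) = c (r + 5)" for r
    using cyc[of r "r + 5" "r + 6"] per[of r] by (simp add: c_def d_def algebra_simps)
  have abc_pos: "0 < a r" "0 < b r" "0 < c r" for r
    by (auto simp: a_def b_def c_def intro!: pos)
  have abc_per: "a (r + 7) = a r" "b (r + 7) = b r" "c (r + 7) = c r" for r
    using per[of r] per[of "r + 1"] per[of "r + 2"] per[of "r + 3"]
    by (simp_all add: a_def b_def c_def d_def algebra_simps)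
  \<comment> \<open>This and the next two bounds are Pluecker relations at the vertices
    \<open>r + 1\<close>, \<open>r + 3\<close> and \<open>r + 5\<close>, each with one strictly
    positive product dropped.\<close>
  have ab1: "c r * b (r + 1) < a r * a (r + 1)" for r
  proof -
    have "0 < d r (r + 1) (r + 4) * d (r + 1) (r + 2) (r + 3)"
      by (intro mult_pos_pos pos) simp_all
    then show ?thesis
      using pluck[of "r + 1" "r + 2" "r + 4" "r + 3" r] cyc[of r "r + 1" "r + 3"] cyc[of r "r + 1" "r + 4"]
        cyc[of r "r + 1" "r + 2"]
      by (simp add: a_def b_def c_def numeral_eq_Suc algebra_simps)
  qed
  have ab2: "a r * c (r + 2) < b r * b (r + 1)" for r
  proof -
    have "0 < d r (r + 3) (r + 4) * d (r + 1) (r + 2) (r + 3)"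
      by (intro mult_pos_pos pos) simp_all
    then show ?thesis
      using pluck[of "r + 3" "r + 4" "r + 1" r "r + 2"] cyc[of "r + 1" "r + 3" "r + 4"]
        cyc[of "r + 3" r "r + 2"] cyc[of r "r + 3" "r + 4"] cyc[of "r + 3" "r + 1" "r + 2"]
        cyc[of "r + 2" "r + 3" "r + 4"] cyc[of "r + 3" r "r + 1"]
      by (simp add: a_def b_def c_def numeral_eq_Suc algebra_simps)
  qed
  have ab3: "c (r + 3) * c (r + 5) < b (r + 3) * a (r + 4)" for r
  proof -
    have "0 < d (r + 4) (r + 5) (r + 6) * d (r + 3) (r + 5) (r + 7)"
      by (intro mult_pos_pos pos) simp_all
    then show ?thesis
      using pluck[of "r + 5" "r + 6" "r + 3" "r + 7" "r + 4"] cyc[of "r + 3" "r + 5" "r + 6"]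
        cyc[of "r + 4" "r + 5" "r + 7"] cyc[of "r + 5" "r + 3" "r + 4"]
        cyc[of "r + 4" "r + 5" "r + 6"] cyc[of "r + 3" "r + 5" "r + 7"]
      by (simp add: a_def b_def c_def numeral_eq_Suc algebra_simps)
  qed
  define L R where "L r \<longleftrightarrow> c (r + 5) * a (r + 1) < c r * c (r + 4)"
    and "R r \<longleftrightarrow> c r * b (r + 3) < c (r + 5) * c (r + 1)" for r
  \<comment> \<open>Multiplying \<open>R r\<close> by \<open>L (r + 3)\<close> and cancelling
    \<open>c r * c (r + 1)\<close> yields the reverse of \<open>ab3\<close>.\<close>
  have R_not_L: "\<not> L (r + 3)" if "R r" for r
  proof
    assume "L (r + 3)"
    then have "c (r + 1) * a (r + 4) < c (r + 3) * c r"
      using abc_per(3)[of r] abc_per(3)[of "r + 1"] by (simp add: L_def algebra_simps)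
    with that have "(c r * b (r + 3)) * (c (r + 1) * a (r + 4)) < (c (r + 5) * c (r + 1)) * (c (r + 3) * c r)"
      using mult_strict_mono[of "c r * b (r + 3)" "c (r + 5) * c (r + 1)" "c (r + 1) * a (r + 4)" "c (r + 3) * c r"]
        abc_pos by (simp add: R_def less_imp_le)
    then have "(c r * c (r + 1)) * (b (r + 3) * a (r + 4)) < (c r * c (r + 1)) * (c (r + 3) * c (r + 5))"
      by (simp add: mult_ac)
    then show False
      using ab3[of r] abc_pos by (simp add: mult_less_cancel_left_pos)
  qed
  have R_per: "R (r + 7 * k) = R r" for r k
  proof (induction k)
    case (Suc k)
    let ?s = "r + 7 * k"
    have "R (?s + 7) = R ?s"
      using abc_per(2)[of "?s + 3"] abc_per(3)[of ?s] abc_per(3)[of "?s + 5"] abc_per(3)[of "?s + 1"]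
      by (simp add: R_def algebra_simps)
    then show ?case using Suc by (simp add: algebra_simps)
  qed simp
  have "\<exists>r. \<not> L r \<and> \<not> R r"
  proof (rule ccontr)
    assume "\<not> ?thesis"
    then have LR: "L r \<or> R r" for r by blast
    obtain r0 where "\<not> L r0"
      using seven_periodic_products(2)[OF abc_pos abc_per ab1 ab2] by (auto simp: L_def not_less)
    then have "R r0" using LR by blast
    then have "R (r0 + 3 * k)" for k
    proof (induction k)
      case (Suc k)
      then show ?case using R_not_L[of "r0 + 3 * k"] LR[of "r0 + 3 * k + 3"] by (simp add: algebra_simps)
    qed simp
    \<comment> \<open>5 is the inverse of 3 modulo 7, and \<open>30 \<equiv> - 5\<close>.\<close>
    then have "R (r0 + 3 * (5 * r + 30 * r0))" for r .
    moreover have "r0 + 3 * (5 * r + 30 * r0) = r + 7 * (2 * r + 13 * r0)" for r by simp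
    ultimately have "R r" for r
      using R_per by metis
    then show False
      using seven_periodic_products(1)[OF abc_pos abc_per ab1 ab2] by (auto simp: R_def not_less[symmetric])
  qed
  moreover have "d r (r + 1) (r + 2) = c r" "d (r + 4) (r + 5) (r + 6) = c (r + 4)"
    "d (r + 1) (r + 2) (r + 4) = a (r + 1)" "d (r + 1) (r + 2) (r + 3) = c (r + 1)"
    "d (r + 3) (r + 5) (r + 6) = b (r + 3)" for r
    by (simp_all add: a_def b_def c_def numeral_eq_Suc)
  ultimately show ?thesis
    by (simp only: wrap L_def R_def not_less)
qed

section \<open>The section of a six-vertex polytope\<close>

text \<open>The vector \<open>s\<^sub>b b + s e - a\<close>, with \<open>s\<^sub>b\<close> forced by the four-point relation of \<open>a, b, c, d\<close>,
  lies in the cone spanned by \<open>b, c, d, e\<close>; the case split in the proof chooses the side of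
  the diagonal \<open>b d\<close>.\<close>

lemma dot3_extension:
  assumes pos: "0 < det3 a b c" "0 < det3 a b d" "0 < det3 a b e" "0 < det3 a c d" "0 < det3 b c d"
      "0 < det3 b c e" "0 < det3 b d e" "0 < det3 c d e"
    and s: "0 \<le> s" "det3 a b c \<le> s * det3 b c e"
    and w: "0 \<le> dot3 b w" "0 \<le> dot3 c w" "0 \<le> dot3 d w" "0 \<le> dot3 e w"
  shows "dot3 a w \<le> det3 a c d / det3 b c d * dot3 b w + s * dot3 e w"
proof -
  have a: "det3 b c d * dot3 a w = det3 a c d * dot3 b w - det3 a b d * dot3 c w + det3 a b c * dot3 d w"
    using cramer_dot[of b c d a w] by (simp add: det3_swap(2)[of a b d] det3_cyclic[of b c a])
  have e: "det3 b c d * dot3 e w = det3 c d e * dot3 b w - det3 b d e * dot3 c w + det3 b c e * dot3 d w"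
    using cramer_dot[of b c d e w] by (simp add: det3_swap(1)[of b d e] det3_cyclic[of c d e])
  define D where "D = det3 a c d * dot3 b w + det3 b c d * (s * dot3 e w) - det3 b c d * dot3 a w"
  have D1: "D = s * det3 c d e * dot3 b w + (det3 a b d - s * det3 b d e) * dot3 c w
      + (s * det3 b c e - det3 a b c) * dot3 d w"
  proof -
    have "D = det3 a c d * dot3 b w + s * (det3 b c d * dot3 e w) - det3 b c d * dot3 a w"
      by (simp add: D_def)
    then show ?thesis unfolding a e by (simp add: algebra_simps)
  qed
  have "0 \<le> D"
  proof (cases "s * det3 b d e \<le> det3 a b d")
    case True
    then have "0 \<le> s * det3 c d e * dot3 b w" "0 \<le> (det3 a b d - s * det3 b d e) * dot3 c w"
      "0 \<le> (s * det3 b c e - det3 a b c) * dot3 d w"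
      using pos s w by simp_all
    then show ?thesis unfolding D1 by linarith
  next
    case False
    \<comment> \<open>Here the coefficient of \<open>c\<close> in \<open>D1\<close> is negative.
      Eliminating \<open>c\<close> in favour of \<open>e\<close> expresses \<open>D\<close> through
      \<open>b\<close>, \<open>d\<close>, \<open>e\<close>, and the Pluecker relation makes the new
      coefficient of \<open>d\<close> positive.\<close>
    have "det3 b d e * D = det3 b d e * (s * det3 c d e * dot3 b w)
       + (s * det3 b d e - det3 a b d) * (- det3 b d e * dot3 c w) + det3 b d e * (s * det3 b c e - det3 a b c) * dot3 d w"
      unfolding D1 by (simp add: algebra_simps)
    also have "- det3 b d e * dot3 c w = det3 b c d * dot3 e w - det3 c d e * dot3 b w - det3 b c e * dot3 d w"
      using e by simp
    also have "det3 b d e * (s * det3 c d e * dot3 b w) + (s * det3 b d e - det3 a b d) *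
        (det3 b c d * dot3 e w - det3 c d e * dot3 b w - det3 b c e * dot3 d w)
        + det3 b d e * (s * det3 b c e - det3 a b c) * dot3 d w =
      (s * det3 b d e - det3 a b d) * (det3 b c d * dot3 e w) + det3 a b d * det3 c d e * dot3 b w
        + (det3 a b d * det3 b c e - det3 a b c * det3 b d e) * dot3 d w"
      by (simp add: algebra_simps)
    also have "det3 a b d * det3 b c e - det3 a b c * det3 b d e = det3 a b e * det3 b c d"
      using plucker[of b c e d a]
      by (simp add: det3_cyclic[of b d a] det3_cyclic[of b e a] det3_cyclic[of b c a] algebra_simps)
    finally have "0 \<le> det3 b d e * D"
      using False pos w by (simp add: add_nonneg_nonneg)
    then show ?thesis using pos by (simp add: zero_le_mult_iff)
  qed
  moreover have "D / det3 b c d = det3 a c d / det3 b c d * dot3 b w + s * dot3 e w - dot3 a w"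
    using pos by (simp add: D_def field_simps)
  ultimately show ?thesis
    using pos divide_nonneg_pos[of D "det3 b c d"] by simp
qed

text \<open>Reflection reverses orientation but keeps inner products, so
  \<open>dot3_extension\<close> serves both exceptional edges.\<close>

fun mirror :: "vec3 \<Rightarrow> vec3" where
  "mirror (x, y, z) = (- x, y, z)"

lemma dot3_mirror: "dot3 (mirror a) (mirror b) = dot3 a b"
  by (cases a; cases b) simp

lemma det3_mirror: "det3 (mirror a) (mirror b) (mirror c) = det3 a c b"
  by (cases a; cases b; cases c) (simp add: algebra_simps)

text \<open>Cramer's rule with the signs of a convex quadrilateral: opposite corners share a side of
  the equation. This supplies the scaling factors.\<close>

lemma four_point_relation:
  assumes "0 < det3 b c d"
  shows "dot3 a w + det3 a b d / det3 b c d * dot3 c w =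
    det3 a c d / det3 b c d * dot3 b w + det3 a b c / det3 b c d * dot3 d w"
  using cramer_dot[of b c d a w] assms
  by (simp add: det3_swap(2)[of a b d] det3_cyclic[of b c a] field_simps)

text \<open>Five of the edges determine the six vertices up to the shift \<open>t\<close>;
  \<open>rel\<close> makes \<open>p_1q_2\<close> and \<open>p_2q_1\<close> pass through P_2 and P_5,
  and \<open>le\<close> is nonnegativity on \<open>p_1q_1\<close> and \<open>p_2q_2\<close>. The
  shift is the freedom in extending the functional of a column to the added dimension, hence may
  differ for each column.\<close>

lemma section_lift:
  fixes a :: "nat \<Rightarrow> 'j \<Rightarrow> real"
  assumes nonneg: "\<And>i j. \<lbrakk>i < 7; j \<in> J\<rbrakk> \<Longrightarrow> 0 \<le> a i j"
    and s: "0 < s1" "0 < s2" "0 < s3" "0 < s4" "0 < s5" "0 < s6"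
    and rel: "\<And>j. j \<in> J \<Longrightarrow> a 0 j + s2 * a 2 j = s1 * a 1 j + s3 * a 3 j"
      "\<And>j. j \<in> J \<Longrightarrow> a 0 j + s5 * a 5 j = s4 * a 4 j + s6 * a 6 j"
    and le: "\<And>j. j \<in> J \<Longrightarrow> a 0 j \<le> s1 * a 1 j + s4 * a 4 j"
      "\<And>j. j \<in> J \<Longrightarrow> a 0 j \<le> s6 * a 6 j + s3 * a 3 j"
  obtains g :: "nat \<Rightarrow> 'j \<Rightarrow> real"
  where "\<And>k j. \<lbrakk>k < 6; j \<in> J\<rbrakk> \<Longrightarrow> 0 \<le> g k j"
    and "\<And>i. i < 7 \<Longrightarrow> \<exists>f. (\<forall>k<6. 0 \<le> f k) \<and> (\<forall>j\<in>J. a i j = (\<Sum>k<6. f k * g k j))"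
proof -
  \<comment> \<open>The entries of column \<open>j\<close> are \<open>p\<^sub>1 + t, p\<^sub>2 + t, p\<^sub>3 + t, q\<^sub>1 - t, q\<^sub>2 - t, q\<^sub>3 - t\<close>, normalised
    by \<open>q\<^sub>3 = 0\<close>; as all sums \<open>p\<^sub>a + q\<^sub>b\<close> are nonnegative, \<open>t = min q\<^sub>b\<close> makes them nonnegative.\<close>
  define t where "t j = min 0 (min (s3 * a 3 j - a 0 j) (s4 * a 4 j - a 0 j))" for j
  define g where "g k j = (if k = 0 then s1 * a 1 j + t j else if k = 1 then s6 * a 6 j + t j
    else if k = 2 then a 0 j + t j else if k = 3 then s4 * a 4 j - a 0 j - t j
    else if k = 4 then s3 * a 3 j - a 0 j - t j else - t j)" for k :: nat and j
  have g_nonneg: "0 \<le> g k j" if "j \<in> J" for k j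
  proof -
    have "0 \<le> s1 * a 1 j" "0 \<le> s2 * a 2 j" "0 \<le> s3 * a 3 j" "0 \<le> s4 * a 4 j" "0 \<le> s5 * a 5 j"
      "0 \<le> s6 * a 6 j" "0 \<le> a 0 j"
      using nonneg[OF _ that] s by simp_all
    then show ?thesis using rel[OF that] le[OF that] unfolding g_def t_def by (simp add: min_def)
  qed
  have two: "\<exists>f. (\<forall>k<6. 0 \<le> f k) \<and> (\<forall>j\<in>J. a i j = (\<Sum>k<6. f k * g k j))"
    if cpq: "0 < c" "p < 6" "q < 6" "\<And>j. j \<in> J \<Longrightarrow> c * a i j = g p j + g q j" for i p q c
  proof (intro exI conjI allI impI ballI)
    let ?f = "\<lambda>k. (if k = p then 1 / c else 0) + (if k = q then 1 / c else 0)"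
    show "0 \<le> ?f k" for k using cpq by simp
    show "a i j = (\<Sum>k<6. ?f k * g k j)" if j: "j \<in> J" for j
    proof -
      have "a i j = (g p j + g q j) / c"
        using cpq(4)[OF j] \<open>0 < c\<close> by (simp add: field_simps)
      also have "\<dots> = (\<Sum>k<6. (if k = p then g k j / c else 0) + (if k = q then g k j / c else 0))"
        using \<open>p < 6\<close> \<open>q < 6\<close> by (simp add: sum.distrib add_divide_distrib)
      also have "\<dots> = (\<Sum>k<6. ?f k * g k j)"
        by (intro sum.cong) (auto simp: add_divide_distrib)
      finally show ?thesis .
    qed
  qed
  have "\<exists>f. (\<forall>k<6. 0 \<le> f k) \<and> (\<forall>j\<in>J. a i j = (\<Sum>k<6. f k * g k j))" if "i < 7" for i
  proof -
    consider "i = 0" | "i = 1" | "i = 2" | "i = 3" | "i = 4" | "i = 5" | "i = 6" using \<open>i < 7\<close> by linarith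
    then show ?thesis
    proof cases
      case 1 then show ?thesis by (intro two[of 1 2 5]) (simp_all add: g_def)
    next
      case 2 then show ?thesis using s by (intro two[of s1 0 5]) (simp_all add: g_def)
    next
      case 3 then show ?thesis using s rel(1) by (intro two[of s2 0 4]) (auto simp: g_def algebra_simps)
    next
      case 4 then show ?thesis using s by (intro two[of s3 2 4]) (simp_all add: g_def)
    next
      case 5 then show ?thesis using s by (intro two[of s4 2 3]) (simp_all add: g_def)
    next
      case 6 then show ?thesis using s rel(2) by (intro two[of s5 1 3]) (auto simp: g_def algebra_simps)
    next
      case 7 then show ?thesis using s by (intro two[of s6 1 5]) (simp_all add: g_def)
    qed
  qed
  with g_nonneg show thesis using that[of g] by blast
qed

lemma heptagon_lift:
  assumes P: "convex_heptagon P" and w: "\<And>i j. j \<in> J \<Longrightarrow> 0 \<le> dot3 (P i) (w j)"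
  shows "\<exists>g :: nat \<Rightarrow> 'j \<Rightarrow> real. (\<forall>k<6. \<forall>j\<in>J. 0 \<le> g k j) \<and>
    (\<forall>i. \<exists>f. (\<forall>k<6. 0 \<le> f k) \<and> (\<forall>j\<in>J. dot3 (P i) (w j) = (\<Sum>k<6. f k * g k j)))"
proof -
  have per: "P (i + 7 * m) = P i" for i m
    using P by (induction m) (simp_all add: convex_heptagon_def add.assoc[symmetric] add.commute[of 7])
  obtain r where r: "det3 (P r) (P (r + 1)) (P (r + 2)) * det3 (P (r + 4)) (P (r + 5)) (P (r + 6)) \<le>
      det3 (P r) (P (r + 5)) (P (r + 6)) * det3 (P (r + 1)) (P (r + 2)) (P (r + 4))"
    "det3 (P r) (P (r + 5)) (P (r + 6)) * det3 (P (r + 1)) (P (r + 2)) (P (r + 3)) \<le>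
      det3 (P r) (P (r + 1)) (P (r + 2)) * det3 (P (r + 3)) (P (r + 5)) (P (r + 6))"
    using balanced_vertex[OF P] by blast
  define Q where "Q i = P (r + i)" for i
  define d where "d i j k = det3 (Q i) (Q j) (Q k)" for i j k
  have pos: "0 < d i j k" if "i < j" "j < k" "k < 7" for i j k
    using P that by (simp add: convex_heptagon_def Q_def d_def)
  have w': "0 \<le> dot3 (Q i) (w j)" if "j \<in> J" for i j
    using w[OF that] by (simp add: Q_def)
  have "d 0 1 2 * d 4 5 6 \<le> d 0 5 6 * d 1 2 4" "d 0 5 6 * d 1 2 3 \<le> d 0 1 2 * d 3 5 6"
    using r by (simp_all add: d_def Q_def)
  moreover have "0 < d 4 5 6" "0 < d 1 2 3" using pos by simp_all
  ultimately have r': "d 0 1 2 \<le> d 0 5 6 / d 4 5 6 * d 1 2 4" "d 0 5 6 \<le> d 0 1 2 / d 1 2 3 * d 3 5 6"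
    by (simp_all add: pos_le_divide_eq)
  obtain g :: "nat \<Rightarrow> 'j \<Rightarrow> real"
  where g: "\<And>k j. \<lbrakk>k < 6; j \<in> J\<rbrakk> \<Longrightarrow> 0 \<le> g k j"
    and f: "\<And>i. i < 7 \<Longrightarrow> \<exists>f. (\<forall>k<6. 0 \<le> f k) \<and> (\<forall>j\<in>J. dot3 (Q i) (w j) = (\<Sum>k<6. f k * g k j))"
  proof (rule section_lift[of J "\<lambda>i j. dot3 (Q i) (w j)" "d 0 2 3 / d 1 2 3" "d 0 1 3 / d 1 2 3"
        "d 0 1 2 / d 1 2 3" "d 0 5 6 / d 4 5 6" "d 0 4 6 / d 4 5 6" "d 0 4 5 / d 4 5 6"])
    show "dot3 (Q 0) (w j) + d 0 1 3 / d 1 2 3 * dot3 (Q 2) (w j) =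
        d 0 2 3 / d 1 2 3 * dot3 (Q 1) (w j) + d 0 1 2 / d 1 2 3 * dot3 (Q 3) (w j)" for j
      using pos unfolding d_def by (intro four_point_relation) simp
    show "dot3 (Q 0) (w j) + d 0 4 6 / d 4 5 6 * dot3 (Q 5) (w j) =
        d 0 5 6 / d 4 5 6 * dot3 (Q 4) (w j) + d 0 4 5 / d 4 5 6 * dot3 (Q 6) (w j)" for j
      using pos unfolding d_def by (intro four_point_relation) simp
    show "dot3 (Q 0) (w j) \<le> d 0 2 3 / d 1 2 3 * dot3 (Q 1) (w j) + d 0 5 6 / d 4 5 6 * dot3 (Q 4) (w j)"
      if "j \<in> J" for j
      unfolding d_def
      by (rule dot3_extension[where c = "Q 2"]) (use w'[OF that] pos r'(1) in \<open>auto simp: d_def less_imp_le\<close>)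
    show "dot3 (Q 0) (w j) \<le> d 0 4 5 / d 4 5 6 * dot3 (Q 6) (w j) + d 0 1 2 / d 1 2 3 * dot3 (Q 3) (w j)"
      if "j \<in> J" for j
    proof -
      have "det3 (Q 6) (Q 4) (Q 5) = det3 (Q 4) (Q 5) (Q 6)" "det3 (Q 6) (Q 3) (Q 5) = det3 (Q 3) (Q 5) (Q 6)"
        "det3 (Q 6) (Q 3) (Q 4) = det3 (Q 3) (Q 4) (Q 6)" "det3 (Q 5) (Q 3) (Q 4) = det3 (Q 3) (Q 4) (Q 5)"
        by (rule det3_cyclic[symmetric])+
      \<comment> \<open>The previous bound for the heptagon traversed backwards: \<open>Q 0\<close>,
        \<open>Q 6\<close>, \<open>Q 5\<close>, \<open>Q 4\<close>, \<open>Q 3\<close>.\<close>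
      then have "dot3 (mirror (Q 0)) (mirror (w j)) \<le>
        det3 (mirror (Q 0)) (mirror (Q 5)) (mirror (Q 4)) / det3 (mirror (Q 6)) (mirror (Q 5)) (mirror (Q 4)) *
          dot3 (mirror (Q 6)) (mirror (w j)) + d 0 1 2 / d 1 2 3 * dot3 (mirror (Q 3)) (mirror (w j))"
        using w'[OF that] pos r'(2)
        by (intro dot3_extension) (auto simp: dot3_mirror det3_mirror d_def less_imp_le)
      then show ?thesis by (simp add: dot3_mirror det3_mirror d_def det3_cyclic)
    qed
  qed (use w' pos in auto)
  show ?thesis
  proof (intro exI[of _ g] conjI allI)
    fix i
    \<comment> \<open>Since 6 is -1 modulo 7, \<open>r + m\<close> is congruent to \<open>i\<close>,
      without subtraction on naturals.\<close>
    define m where "m = (i + 6 * r) mod 7"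
    have split: "r + m + 7 * ((i + 6 * r) div 7) = i + 7 * r"
      using mod_mult_div_eq[of "i + 6 * r" 7] by (simp add: m_def)
    have "P i = Q m"
      using per[of i r] per[of "r + m" "(i + 6 * r) div 7"] unfolding split Q_def by simp
    then show "\<exists>f. (\<forall>k<6. 0 \<le> f k) \<and> (\<forall>j\<in>J. dot3 (P i) (w j) = (\<Sum>k<6. f k * g k j))"
      using f[of m] by (simp add: m_def)
  qed (use g in blast)
qed

section \<open>Nonnegative factorizations\<close>

text \<open>An arbitrary finite index set for the inner dimension allows a row to be deleted without
  renumbering.\<close>

lemma nonneg_rank_le_card:
  fixes f :: "nat \<Rightarrow> 'k \<Rightarrow> real" and g :: "'k \<Rightarrow> nat \<Rightarrow> real"
  assumes A: "A \<in> carrier_mat m n" and S: "finite S"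
    and f: "\<And>i s. \<lbrakk>i < m; s \<in> S\<rbrakk> \<Longrightarrow> 0 \<le> f i s"
    and g: "\<And>s j. \<lbrakk>s \<in> S; j < n\<rbrakk> \<Longrightarrow> 0 \<le> g s j"
    and eq: "\<And>i j. \<lbrakk>i < m; j < n\<rbrakk> \<Longrightarrow> A $$ (i, j) = (\<Sum>s\<in>S. f i s * g s j)"
  shows "nonneg_rank A \<le> card S"
proof -
  obtain h where h: "bij_betw h {0..<card S} S"
    using ex_bij_betw_nat_finite[OF S] by blast
  then have hS: "h a \<in> S" if "a < card S" for a
    using that by (auto simp: bij_betw_def)
  define B C where "B = mat m (card S) (\<lambda>(i, a). f i (h a))" and "C = mat (card S) n (\<lambda>(a, j). g (h a) j)"
  have "A = B * C"
  proof (rule eq_matI)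
    fix i j assume "i < dim_row (B * C)" "j < dim_col (B * C)"
    then have ij: "i < m" "j < n" by (simp_all add: B_def C_def)
    have "A $$ (i, j) = (\<Sum>a\<in>{0..<card S}. f i (h a) * g (h a) j)"
      using eq[OF ij] sum.reindex_bij_betw[OF h, of "\<lambda>s. f i s * g s j"] by simp
    also have "\<dots> = (B * C) $$ (i, j)"
      using ij by (simp add: B_def C_def scalar_prod_def)
    finally show "A $$ (i, j) = (B * C) $$ (i, j)" .
  qed (use A in \<open>simp_all add: B_def C_def\<close>)
  moreover have "nonneg_mat B" "nonneg_mat C"
    using f g hS by (auto simp: nonneg_mat_def B_def C_def)
  ultimately have "nonneg_factorization A (card S) B C"
    using A by (auto simp: nonneg_factorization_def B_def C_def)
  then show ?thesis
    unfolding nonneg_rank_def by (intro Least_le) blast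
qed

text \<open>The right factor consists of the other rows of \<open>A\<close>; the left one is an
  identity matrix with the coefficients \<open>c\<close> inserted as row \<open>i\<close>.\<close>

lemma nonneg_rank_redundant_row:
  assumes A: "A \<in> carrier_mat m n" "nonneg_mat A" and i: "i < m"
    and c: "\<And>k. 0 \<le> c k"
    and row: "\<And>j. j < n \<Longrightarrow> A $$ (i, j) = (\<Sum>k\<in>{..<m} - {i}. c k * A $$ (k, j))"
  shows "nonneg_rank A \<le> m - 1"
proof -
  have "nonneg_rank A \<le> card ({..<m} - {i})"
  proof (rule nonneg_rank_le_card[OF A(1), where g = "\<lambda>k j. A $$ (k, j)" and
        f = "\<lambda>l k. if l = i then c k else if k = l then 1 else 0"])
    show "A $$ (l, j) = (\<Sum>k\<in>{..<m} - {i}. (if l = i then c k else if k = l then 1 else 0) * A $$ (k, j))"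
      if "l < m" "j < n" for l j
    proof (cases "l = i")
      case False
      have "(\<Sum>k\<in>{..<m} - {i}. (if k = l then 1 else 0) * A $$ (k, j)) =
          (\<Sum>k\<in>{..<m} - {i}. if k = l then A $$ (k, j) else 0)"
        by (intro sum.cong) auto
      with False that show ?thesis by simp
    qed (use row that in simp)
  qed (use A c in \<open>auto simp: nonneg_mat_def\<close>)
  then show ?thesis using i by simp
qed

text \<open>A maximal independent set of columns has as many elements as the rank and spans every
  column.\<close>

lemma rank_factorization:
  fixes A :: "'a :: field mat"
  assumes A: "A \<in> carrier_mat m n"
  obtains U W where "\<And>i j. \<lbrakk>i < m; j < n\<rbrakk> \<Longrightarrow> A $$ (i, j) = (\<Sum>l<vec_space.rank m A. U i l * W l j)"
proof -
  interpret vec_space "TYPE('a)" m .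
  have cols: "set (cols A) \<subseteq> carrier_vec m" using cols_dim A by blast
  have "lin_indpt {}" by (simp add: lin_dep_def)
  then obtain S where fin: "finite S" and max: "maximal S (\<lambda>T. T \<subseteq> set (cols A) \<and> lin_indpt T)"
    using maximal_exists_superset[of "set (cols A)" "\<lambda>T. T \<subseteq> set (cols A) \<and> lin_indpt T" "{}"] by auto
  have S: "S \<subseteq> set (cols A)" "lin_indpt S" using max by (auto simp: maximal_def)
  have card: "rank A = card S" using rank_card_indpt[OF A max] .
  have Sc: "S \<subseteq> carrier_vec m" using S cols by blast
  have "\<exists>c. \<forall>i<m. A $$ (i, j) = (\<Sum>x\<in>S. c x * x $ i)" if j: "j < n" for j
  proof -
    have mem: "col A j \<in> set (cols A)" using A j by (simp add: cols_def)
    have "col A j \<in> span S"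
    proof (cases "col A j \<in> S")
      case True
      then show ?thesis using span_mem Sc by blast
    next
      case False
      have "\<not> lin_indpt (S \<union> {col A j})"
        using max mem False S unfolding maximal_def by blast
      then show ?thesis
        using lin_dep_iff_in_span[of S "col A j"] Sc S False mem cols by auto
    qed
    then obtain c where "lincomb c S = col A j" using finite_in_span[OF fin] Sc by auto
    then have "A $$ (i, j) = (\<Sum>x\<in>S. c x * x $ i)" if "i < m" for i
      using lincomb_index[OF that Sc, of c] A j that by simp
    then show ?thesis by blast
  qed
  then obtain c where c: "\<And>i j. \<lbrakk>i < m; j < n\<rbrakk> \<Longrightarrow> A $$ (i, j) = (\<Sum>x\<in>S. c j x * x $ i)" by metis
  obtain h where h: "bij_betw h {0..<card S} S" using ex_bij_betw_nat_finite[OF fin] by blast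
  show thesis
  proof (rule that[of "\<lambda>i l. h l $ i" "\<lambda>l j. c j (h l)"])
    show "A $$ (i, j) = (\<Sum>l<rank A. h l $ i * c j (h l))" if "i < m" "j < n" for i j
      using c[OF that] sum.reindex_bij_betw[OF h, of "\<lambda>x. c j x * x $ i"]
      by (simp add: card lessThan_atLeast0 mult.commute)
  qed
qed

section \<open>Reduction of the matrix to a strictly convex heptagon\<close>

theorem theorem3p1:
  fixes A :: "real mat" and n :: nat
  assumes "A \<in> carrier_mat 7 n"
    and "nonneg_mat A"
    and "vec_space.rank 7 A = 3"
  shows "nonneg_rank A \<le> 6"
proof (rule ccontr)
  assume large: "\<not> nonneg_rank A \<le> 6"
  obtain U W :: "nat \<Rightarrow> nat \<Rightarrow> real" where UW: "\<And>i j. \<lbrakk>i < 7; j < n\<rbrakk> \<Longrightarrow> A $$ (i, j) = (\<Sum>l<3. U i l * W l j)"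
    using rank_factorization[OF assms(1), unfolded assms(3)] by blast
  define u w where "u i = (U i 0, U i 1, U i 2)" and "w j = (W 0 j, W 1 j, W 2 j)" for i j
  have A: "A $$ (i, j) = dot3 (u i) (w j)" if "i < 7" "j < n" for i j
    using UW[OF that] by (simp add: u_def w_def numeral_3_eq_3 numeral_2_eq_2)
  have A_nonneg: "0 \<le> A $$ (i, j)" if "i < 7" "j < n" for i j
    using assms(1,2) that by (auto simp: nonneg_mat_def)
  \<comment> \<open>Pairing with \<open>e\<close> gives row sums. They are positive because a zero
    row would be redundant.\<close>
  define e where "e = (\<Sum>j<n. w j)"
  have dot_e: "dot3 (u i) e = (\<Sum>j<n. A $$ (i, j))" if "i < 7" for i
    using A that by (simp add: e_def dot3_sum_right)
  have extreme: "u i \<noteq> x *\<^sub>R u j + y *\<^sub>R u k + z *\<^sub>R u l"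
    if I: "i < 7" "j < 7" "k < 7" "l < 7" "i \<notin> {j, k, l}" "0 \<le> x" "0 \<le> y" "0 \<le> z" for i j k l x y z
  proof
    assume *: "u i = x *\<^sub>R u j + y *\<^sub>R u k + z *\<^sub>R u l"
    \<comment> \<open>The coefficients are added because \<open>j\<close>, \<open>k\<close>,
      \<open>l\<close> may coincide.\<close>
    let ?c = "\<lambda>s. (if s = j then x else 0) + (if s = k then y else 0) + (if s = l then z else 0)"
    have "nonneg_rank A \<le> 7 - 1"
    proof (rule nonneg_rank_redundant_row[OF assms(1,2) I(1), of ?c])
      show "0 \<le> ?c s" for s using I by simp
      fix p assume p: "p < n"
      have "(\<Sum>s\<in>{..<7} - {i}. ?c s * A $$ (s, p)) = (\<Sum>s\<in>{..<7} - {i}. (if s = j then x * A $$ (s, p) else 0)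
        + (if s = k then y * A $$ (s, p) else 0) + (if s = l then z * A $$ (s, p) else 0))"
        by (intro sum.cong) (auto simp: algebra_simps)
      also have "\<dots> = x * A $$ (j, p) + y * A $$ (k, p) + z * A $$ (l, p)"
        using I by (simp add: sum.distrib)
      also have "\<dots> = A $$ (i, p)"
        using * A p I by (simp add: dot3_linear)
      finally show "A $$ (i, p) = (\<Sum>s\<in>{..<7} - {i}. ?c s * A $$ (s, p))" by simp
    qed
    with large show False by simp
  qed
  have "0 < dot3 (u i) e" if i: "i < 7" for i
  proof (rule ccontr)
    assume "\<not> ?thesis"
    then have "(\<Sum>j<n. A $$ (i, j)) = 0"
      using dot_e[OF i] sum_nonneg[of "{..<n}" "\<lambda>j. A $$ (i, j)"] A_nonneg[OF i] by simp
    then have "A $$ (i, j) = 0" if "j < n" for j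
      using sum_nonneg_eq_0_iff[of "{..<n}" "\<lambda>j. A $$ (i, j)"] A_nonneg[OF i] that by simp
    then have "nonneg_rank A \<le> 7 - 1"
      by (intro nonneg_rank_redundant_row[OF assms(1,2) i, of "\<lambda>_. 0"]) simp_all
    with large show False by simp
  qed
  then interpret convex_position u "{..<7}" e
    by unfold_locales (use extreme in auto)
  obtain P where P: "convex_heptagon P" "range P = u ` {..<7}"
    using obtain_heptagon by auto
  have Pw: "0 \<le> dot3 (P i) (w j)" if "j \<in> {..<n}" for i j
  proof -
    have "P i \<in> u ` {..<7}" using P(2) by blast
    then obtain l where "l < 7" "P i = u l" by auto
    then show ?thesis using A_nonneg[of l j] A[of l j] that by simp
  qed
  have "\<exists>g :: nat \<Rightarrow> nat \<Rightarrow> real. (\<forall>k<6. \<forall>j\<in>{..<n}. 0 \<le> g k j) \<and>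
      (\<forall>i. \<exists>f. (\<forall>k<6. 0 \<le> f k) \<and> (\<forall>j\<in>{..<n}. dot3 (P i) (w j) = (\<Sum>k<6. f k * g k j)))"
    by (rule heptagon_lift[OF P(1) Pw])
  then obtain g where gf: "(\<forall>k<6. \<forall>j\<in>{..<n}. 0 \<le> g k j) \<and>
      (\<forall>i. \<exists>f. (\<forall>k<6. 0 \<le> f k) \<and> (\<forall>j\<in>{..<n}. dot3 (P i) (w j) = (\<Sum>k<6::nat. f k * g k j)))" ..
  have "\<exists>f. (\<forall>k<6. 0 \<le> f k) \<and> (\<forall>j<n. A $$ (i, j) = (\<Sum>k<6. f k * g k j))" if i: "i < 7" for i
  proof -
    have "u i \<in> range P" using P(2) i by simp
    then obtain l where l: "u i = P l" by blast
    obtain h where "\<forall>k<6. 0 \<le> h k" "\<forall>j\<in>{..<n}. dot3 (P l) (w j) = (\<Sum>k<6. h k * g k j)"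
      using conjunct2[OF gf] by metis
    then show ?thesis using A i l by (intro exI[of _ h]) simp
  qed
  then obtain F where "\<And>i. i < 7 \<Longrightarrow> (\<forall>k<6. 0 \<le> F i k) \<and> (\<forall>j<n. A $$ (i, j) = (\<Sum>k<6. F i k * g k j))"
    by metis
  then have "nonneg_rank A \<le> card {..<6::nat}"
    using conjunct1[OF gf] by (intro nonneg_rank_le_card[OF assms(1), of _ F g]) auto
  with large show False by simp
qed

end
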